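(* There are infinitely many integer quintuples $(a,b,c,r,s)$ with $a>1$, $b>1$, $c>0$, $r>0$, $s>0$ and $\gcd(ra,sb)=1$ for which the equation $(-1)^u r a^x + (-1)^v s b^y = c$ has exactly three solutions $(x,y,u,v)$ (with $x,y$ nonnegative integers and $u,v\in\{0,1\}$); this remains true even if one considers only sets of solutions in basic form.
   Context: A set of solutions $(a,b,c,r,s;x_1,y_1,\dots,x_N,y_N)$ is the unordered set of $N>2$ distinct pairs $(x_i,y_i)$, each giving a solution for the given $a,b,c,r,s$ (the pair $(x,y)$ determines $(u,v)$). It is in basic form if $\gcd(r,sb)=\gcd(s,ra)=1$, $\min_i x_i=\min_i y_i=0$, and neither $a$ nor $b$ is a perfect power. *)

theory Defs
  imports "HOL-Computational_Algebra.Nth_Powers"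
begin

definition is_solution :: "int \<Rightarrow> int \<Rightarrow> int \<Rightarrow> int \<Rightarrow> int \<Rightarrow> nat \<Rightarrow> nat \<Rightarrow> nat \<Rightarrow> nat \<Rightarrow> bool" where
  "is_solution a b c r s x y u v \<longleftrightarrow>
     u \<in> {0, 1} \<and> v \<in> {0, 1} \<and> (-1) ^ u * r * a ^ x + (-1) ^ v * s * b ^ y = c"

definition solutions :: "int \<Rightarrow> int \<Rightarrow> int \<Rightarrow> int \<Rightarrow> int \<Rightarrow> (nat \<times> nat \<times> nat \<times> nat) set" where
  "solutions a b c r s = {(x, y, u, v). is_solution a b c r s x y u v}"

(* A set of solutions need not be complete: it may omit pairs that also give a solution.
   The cardinality condition also forces P to be finite. *)
definition set_of_solutions ::
  "int \<Rightarrow> int \<Rightarrow> int \<Rightarrow> int \<Rightarrow> int \<Rightarrow> (nat \<times> nat) set \<Rightarrow> bool" where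
  "set_of_solutions a b c r s P \<longleftrightarrow>
     card P > 2 \<and> (\<forall>(x, y) \<in> P. \<exists>u v. is_solution a b c r s x y u v)"

definition perfect_power :: "int \<Rightarrow> bool" where
  "perfect_power n \<longleftrightarrow> (\<exists>k\<ge>2. is_nth_power k n)"

definition basic_form ::
  "int \<Rightarrow> int \<Rightarrow> int \<Rightarrow> int \<Rightarrow> int \<Rightarrow> (nat \<times> nat) set \<Rightarrow> bool" where
  "basic_form a b c r s P \<longleftrightarrow>
     set_of_solutions a b c r s P \<and>
     gcd r (s * b) = 1 \<and> gcd s (r * a) = 1 \<and>
     Min (fst ` P) = 0 \<and> Min (snd ` P) = 0 \<and>
     \<not> perfect_power a \<and> \<not> perfect_power b"

end

theory Submission
  imports Defs "HOL-Number_Theory.Cong"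
begin

text \<open>
  For every \<open>r\<close>, the choice \<open>b = 2r + 1\<close>, \<open>a = 4r + 3\<close>, \<open>c = r + 1\<close>, \<open>s = 1\<close> has the solutions
  \<open>r + 1 = c\<close>, \<open>b - r = c\<close> and \<open>b\<^sup>2 - r a = c\<close>. Comparing sizes and reducing modulo \<open>r\<close> shows that any
  other solution has the shape \<open>b\<^sup>y - r a\<^sup>x = c\<close> with \<open>x \<ge> 2\<close>. If \<open>r \<equiv> 3 (mod 25)\<close>, then \<open>5\<close> divides
  \<open>a\<close> and \<open>b \<equiv> 7\<close> has order 4 modulo 25, so such a solution would give \<open>7\<^sup>y \<equiv> 4 (mod 25)\<close>, whereas
  the powers of 7 modulo 25 are 1, 7, 24, 18. Finally \<open>r \<equiv> 1 (mod 9)\<close> makes 3 divide \<open>b\<close> exactly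
  once, and 5 divides \<open>a\<close> exactly once, so neither is a perfect power.
\<close>

text \<open>A prime dividing \<open>m ^ k\<close> divides \<open>m\<close>, so for
  \<open>k >= 2\<close> its square divides \<open>m ^ k\<close>.\<close>

lemma not_perfect_power_if_prime_exactly_divides:
  fixes p n :: int
  assumes "prime p" "p dvd n" "\<not> p\<^sup>2 dvd n"
  shows "\<not> perfect_power n"
proof
  assume "perfect_power n"
  then obtain k m where k: "k \<ge> 2" and n: "n = m ^ k"
    by (auto simp: perfect_power_def is_nth_power_def)
  have "p dvd m"
    using assms n prime_dvd_power by blast
  then have "p\<^sup>2 dvd n"
    unfolding n using k by (meson dvd_power_le)
  then show False
    using assms by simp
qed

lemma power_7_mod_25: "(7::int) ^ y mod 25 \<in> {1, 7, 24, 18}"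
proof (induction y)
  case (Suc y)
  have "(7::int) ^ Suc y mod 25 = (7 * (7 ^ y mod 25)) mod 25"
    by (simp add: mod_mult_right_eq)
  with Suc show ?case by auto
qed auto

text \<open>The bound on \<open>x\<close> puts two factors 5 into the power of
  \<open>4 * r + 3\<close>, so the term with \<open>r\<close> vanishes modulo 25. For
  \<open>x = 1\<close> the equation does hold, with \<open>y = 2\<close>.\<close>

lemma no_solution_if_two_le_exponent:
  fixes r :: int
  assumes "r mod 25 = 3" "x \<ge> 2"
  shows "(2 * r + 1) ^ y - r * (4 * r + 3) ^ x \<noteq> r + 1"
proof
  assume eq: "(2 * r + 1) ^ y - r * (4 * r + 3) ^ x = r + 1"
  have r: "[r = 3] (mod 25)"
    using assms by (simp add: cong_def)
  have "5 dvd 4 * r + 3"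
    using assms(1) by presburger
  then have "(5::int)\<^sup>2 dvd (4 * r + 3) ^ x"
    using assms(2) by (meson dvd_power_le)
  then have a: "[(4 * r + 3) ^ x = 0] (mod 25)"
    by (simp add: cong_0_iff)
  have "(2 * r + 1) mod 25 = 7"
    using assms(1) by presburger
  then have b: "[(2 * r + 1) ^ y = 7 ^ y] (mod 25)"
    by (intro cong_pow) (simp add: cong_def)
  have "[(2 * r + 1) ^ y - r * (4 * r + 3) ^ x = 7 ^ y - 3 * 0] (mod 25)"
    by (intro cong_diff cong_mult r a b)
  moreover have "[r + 1 = 3 + 1] (mod 25)"
    by (intro cong_add r cong_refl)
  ultimately have "(7::int) ^ y mod 25 = 4"
    unfolding eq by (simp add: cong_def)
  then show False
    using power_7_mod_25[of y] by simp
qed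

lemma solutions_family:
  fixes r :: int
  assumes "r mod 25 = 3" "r > 2"
  shows "solutions (4 * r + 3) (2 * r + 1) (r + 1) r 1
           = {(0, 0, 0, 0), (0, 1, 1, 0), (1, 2, 1, 0)}"
proof -
  define a b where "a = 4 * r + 3" and "b = 2 * r + 1"
  have gt: "a > 1" "b > 1"
    using assms by (auto simp: a_def b_def)
  \<comment> \<open>Size argument: for \<open>x > 0\<close> the first term alone is at least
    \<open>3 * r\<close>, which exceeds \<open>r + 1\<close>.\<close>
  have both_plus: "x = 0 \<and> y = 0" if eq: "r * a ^ x + b ^ y = r + 1" for x y
  proof -
    have "x = 0"
    proof (rule ccontr)
      assume "x \<noteq> 0"
      then have "a \<le> a ^ x"
        using gt by (intro self_le_power) auto
      then have "r * a \<le> r * a ^ x"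
        using assms by simp
      moreover have "r * 3 \<le> r * a"
        using assms by (simp add: a_def)
      moreover have "b ^ y > 0"
        using gt by simp
      ultimately show False
        using eq assms by linarith
    qed
    moreover from this have "b ^ y = 1"
      using eq by simp
    ultimately show ?thesis
      using gt by (cases y) (auto simp: zmult_eq_1_iff)
  qed
  \<comment> \<open>Modulo \<open>r\<close> the equation reads -1 = 1, because \<open>b\<close> is 1
    there; this forces \<open>r\<close> to divide 2.\<close>
  have minus_second: False if eq: "r * a ^ x - b ^ y = r + 1" for x y
  proof -
    have "[b = 1] (mod r)"
      by (simp add: b_def cong_iff_dvd_diff)
    then have "[b ^ y = 1 ^ y] (mod r)"
      by (rule cong_pow)
    then have "r dvd b ^ y - 1"
      by (simp add: cong_iff_dvd_diff)
    moreover have "2 = r * (a ^ x - 1) - (b ^ y - 1)"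
      using eq by (simp add: algebra_simps)
    ultimately have "r dvd 2"
      by (metis dvd_diff dvd_triv_left)
    then show False
      using assms zdvd_imp_le by fastforce
  qed
  have minus_first: "(x = 0 \<and> y = 1) \<or> (x = 1 \<and> y = 2)"
    if eq: "b ^ y - r * a ^ x = r + 1" for x y
  proof -
    have "x < 2"
      using eq no_solution_if_two_le_exponent[OF assms(1)]
      by (metis a_def b_def not_less)
    then consider "x = 0" | "x = 1" by linarith
    then show ?thesis
    proof cases
      case 1
      then have "b ^ y = b ^ 1"
        using eq by (simp add: b_def)
      then show ?thesis
        using 1 gt power_inject_exp by blast
    next
      case 2
      \<comment> \<open>The choice of \<open>a\<close> makes \<open>r * a + r + 1\<close> the
        perfect square \<open>(2 * r + 1)^2\<close>.\<close>
      then have "b ^ y = b ^ 2"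
        using eq by (simp add: a_def b_def power2_eq_square algebra_simps)
      then show ?thesis
        using 2 gt power_inject_exp by blast
    qed
  qed
  have both_minus: False if eq: "- (r * a ^ x) - b ^ y = r + 1" for x y
  proof -
    have "r * a ^ x > 0" "b ^ y > 0"
      using gt assms by auto
    then show False
      using eq assms by linarith
  qed
  have "is_solution a b (r + 1) r 1 x y u v \<longleftrightarrow>
          (x, y, u, v) \<in> {(0, 0, 0, 0), (0, 1, 1, 0), (1, 2, 1, 0)}" for x y u v
  proof
    assume "is_solution a b (r + 1) r 1 x y u v"
    then show "(x, y, u, v) \<in> {(0, 0, 0, 0), (0, 1, 1, 0), (1, 2, 1, 0)}"
      using both_plus[of x y] minus_second[of x y] minus_first[of y x] both_minus[of x y]
      by (auto simp: is_solution_def)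
  next
    assume "(x, y, u, v) \<in> {(0, 0, 0, 0), (0, 1, 1, 0), (1, 2, 1, 0)}"
    then show "is_solution a b (r + 1) r 1 x y u v"
      by (auto simp: is_solution_def a_def b_def power2_eq_square algebra_simps)
  qed
  then show ?thesis
    by (auto simp: solutions_def a_def b_def)
qed

lemma coprime_family:
  fixes r :: int
  shows "coprime r (2 * r + 1)" "coprime (4 * r + 3) (2 * r + 1)"
proof -
  show "coprime r (2 * r + 1)"
    by (rule coprimeI) (metis dvd_add_right_iff dvd_mult)
  show "coprime (4 * r + 3) (2 * r + 1)"
  proof (rule coprimeI)
    fix d assume "d dvd 4 * r + 3" "d dvd 2 * r + 1"
    then have "d dvd (4 * r + 3) - 2 * (2 * r + 1)"
      by (intro dvd_diff dvd_mult)
    then show "is_unit d" by simp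
  qed
qed

lemma basic_form_family:
  fixes r :: int
  assumes "r mod 25 = 3" "r mod 9 = 1" "r > 2"
  shows "basic_form (4 * r + 3) (2 * r + 1) (r + 1) r 1 {(0, 0), (0, 1), (1, 2)}"
proof -
  have "\<not> perfect_power (4 * r + 3)"
  proof (rule not_perfect_power_if_prime_exactly_divides)
    show "prime (5::int)" by simp
    show "5 dvd 4 * r + 3"
      using assms(1) by presburger
    \<comment> \<open>Here \<open>4 * r + 3\<close> is 15 modulo 25.\<close>
    have "\<not> 25 dvd 4 * r + 3"
      using assms(1) by presburger
    then show "\<not> 5\<^sup>2 dvd 4 * r + 3" by simp
  qed
  moreover have "\<not> perfect_power (2 * r + 1)"
  proof (rule not_perfect_power_if_prime_exactly_divides)
    show "prime (3::int)" by simp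
    show "3 dvd 2 * r + 1"
      using assms(2) by presburger
    \<comment> \<open>Here \<open>2 * r + 1\<close> is 3 modulo 9.\<close>
    have "\<not> 9 dvd 2 * r + 1"
      using assms(2) by presburger
    then show "\<not> 3\<^sup>2 dvd 2 * r + 1" by simp
  qed
  moreover have "set_of_solutions (4 * r + 3) (2 * r + 1) (r + 1) r 1 {(0, 0), (0, 1), (1, 2)}"
  proof -
    let ?sol = "is_solution (4 * r + 3) (2 * r + 1) (r + 1) r 1"
    have "?sol x y u v" if "(x, y, u, v) \<in> {(0, 0, 0, 0), (0, 1, 1, 0), (1, 2, 1, 0)}" for x y u v
      using that unfolding solutions_family[OF assms(1,3), symmetric] by (simp add: solutions_def)
    then have "?sol 0 0 0 0" "?sol 0 1 1 0" "?sol 1 2 1 0"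
      by blast+
    then show ?thesis
      unfolding set_of_solutions_def by auto
  qed
  ultimately show ?thesis
    using coprime_family(1)[of r] by (simp add: basic_form_def)
qed

theorem theorem3:
  shows "infinite {(a, b, c, r, s).
             a > 1 \<and> b > 1 \<and> c > 0 \<and> r > 0 \<and> s > 0 \<and> gcd (r * a) (s * b) = 1 \<and>
             card (solutions a b c r s) = 3}
       \<and> infinite {(a, b, c, r, s).
             a > 1 \<and> b > 1 \<and> c > 0 \<and> r > 0 \<and> s > 0 \<and> gcd (r * a) (s * b) = 1 \<and>
             card (solutions a b c r s) = 3 \<and> (\<exists>P. basic_form a b c r s P)}"
    (is "infinite ?A \<and> infinite ?B")
proof
  \<comment> \<open>By the Chinese remainder theorem the conditions 3 modulo 25 and 1 modulo 9
    describe one class modulo 225, that of 28.\<close>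
  define f :: "nat \<Rightarrow> int \<times> int \<times> int \<times> int \<times> int" where
    "f n = (let r = 225 * int n + 28 in (4 * r + 3, 2 * r + 1, r + 1, r, 1))" for n
  have "f n \<in> ?B" for n
  proof -
    define r where "r = 225 * int n + 28"
    have r: "r mod 25 = 3" "r mod 9 = 1" "r > 2"
      unfolding r_def by presburger+
    have "gcd (r * (4 * r + 3)) (1 * (2 * r + 1)) = 1"
      using coprime_family[of r] by simp
    moreover have "card (solutions (4 * r + 3) (2 * r + 1) (r + 1) r 1) = 3"
      by (simp add: solutions_family[OF r(1,3)])
    moreover have "f n = (4 * r + 3, 2 * r + 1, r + 1, r, 1)"
      by (simp add: f_def r_def Let_def)
    ultimately show ?thesis
      using r basic_form_family[OF r] by auto
  qed
  then have "range f \<subseteq> ?B"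
    by (rule image_subsetI)
  moreover have "inj f"
    by (auto simp: inj_def f_def Let_def)
  ultimately show B: "infinite ?B"
    by (meson finite_imageD finite_subset infinite_UNIV_nat)
  have "?B \<subseteq> ?A" by auto
  then show "infinite ?A"
    using B infinite_super by blast
qed

end
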